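(* Let $X=\mathrm{Cay}(\mathbb{Z}_4\times\mathbb{Z}_4,S)$ with $S=\{(1,0),(3,0),(0,1),(0,3),(1,1),(3,3)\}$, which is an undirected Cayley graph of a finite abelian group. Then $X$ does not have the Tinhofer property. In particular, not every undirected Cayley graph of a finite abelian group has the Tinhofer property.
   Context: Graphs are directed graphs without loops (undirected graphs are the special case of a symmetric edge relation). For a finite group $A$ with neutral element $e$ and $S\subseteq A\setminus\{e\}$, the Cayley graph $\mathrm{Cay}(A,S)$ has vertex set $A$ and edge set $\{(h,sh): h\in A, s\in S\}$ (here with additive notation, $(h,s+h)$). Color Refinement: given a coloring $c$ of the vertices of a graph $(V,E)$, one step refines the coloring by splitting vertices: two vertices $v,v'$ keep the same color iff $c(v)=c(v')$ and the multisets $\{\{c(h): h\in V, (h,v)\in E\}\}$ and $\{\{c(h): h\in V, (h,v')\in E\}\}$ of colors of in-neighbors coincide. The step is repeated until the partition of the vertices into color classes stabilizes. Tinhofer's algorithm for two graphs $G$ and $H$: (1) Give every vertex of the disjoint union of $G$ and $H$ the same color. (2) Run Color Refinement on the current coloring of $V(G)\cup V(H)$ (in the disjoint union) until it stabilizes. (3) If the multisets of colors in $G$ and $H$ are different, decide that $G$ and $H$ are not isomorphic. (4) If all vertices of $G$ (equivalently of $H$) are colored uniquely (within that graph), decide that $G$ and $H$ are isomorphic. (5) Choose a color class with at least two vertices in both $G$ and $H$, select $v\in V(G)$ and $w\in V(H)$ in this class and give them the same new unique color. Repeat from step (2). A graph $G$ has the Tinhofer property if this algorithm gives the correct answer (whether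 $G\cong H$) for every graph $H$ and every choice of color classes and vertices in step (5). *)

theory Defs
  imports "Graph_Theory.Graph_Theory" "HOL-Algebra.Elementary_Groups" "HOL-Library.Multiset"
begin

text \<open>
  Finite loopless directed graphs are \<^locale>\<open>pair_digraph\<close>s; undirected graphs are those with
  \<^const>\<open>symmetric\<close> arc relation; isomorphism is \<^const>\<open>digraph_iso\<close>.
\<close>

definition cayley_graph :: "('a, 'b) monoid_scheme \<Rightarrow> 'a set \<Rightarrow> 'a pair_pre_digraph" where
  "cayley_graph A S = \<lparr> pverts = carrier A,
     parcs = {(h, s \<otimes>\<^bsub>A\<^esub> h) | h s. h \<in> carrier A \<and> s \<in> S} \<rparr>"

definition disjoint_union ::
    "'a pair_pre_digraph \<Rightarrow> 'b pair_pre_digraph \<Rightarrow> ('a + 'b) pair_pre_digraph" where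
  "disjoint_union G H = \<lparr> pverts = pverts G <+> pverts H,
     parcs = map_prod Inl Inl ` parcs G \<union> map_prod Inr Inr ` parcs H \<rparr>"


subsection \<open>Color Refinement\<close>

text \<open>
  Colors are natural numbers. One step determines the new coloring only up to renaming of the
  colors, hence it is a relation between the old coloring and the new one. Only the values of a
  coloring on the vertex set matter.
\<close>

definition in_colors :: "'a pair_pre_digraph \<Rightarrow> ('a \<Rightarrow> nat) \<Rightarrow> 'a \<Rightarrow> nat multiset" where
  "in_colors G c v = image_mset c (mset_set {h \<in> pverts G. (h, v) \<in> parcs G})"

definition refinement_step ::
    "'a pair_pre_digraph \<Rightarrow> ('a \<Rightarrow> nat) \<Rightarrow> ('a \<Rightarrow> nat) \<Rightarrow> bool" where
  "refinement_step G c c' \<longleftrightarrow> (\<forall>v\<in>pverts G. \<forall>v'\<in>pverts G.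
     c' v = c' v' \<longleftrightarrow> c v = c v' \<and> in_colors G c v = in_colors G c v')"

definition same_partition ::
    "'a pair_pre_digraph \<Rightarrow> ('a \<Rightarrow> nat) \<Rightarrow> ('a \<Rightarrow> nat) \<Rightarrow> bool" where
  "same_partition G c c' \<longleftrightarrow>
     (\<forall>v\<in>pverts G. \<forall>v'\<in>pverts G. c v = c v' \<longleftrightarrow> c' v = c' v')"

text \<open>\<open>color_refinement G c d\<close>: iterating the step from \<open>c\<close> until stabilization can end in \<open>d\<close>.\<close>

inductive color_refinement ::
    "'a pair_pre_digraph \<Rightarrow> ('a \<Rightarrow> nat) \<Rightarrow> ('a \<Rightarrow> nat) \<Rightarrow> bool" for G where
  stable:
    "refinement_step G c c' \<Longrightarrow> same_partition G c c' \<Longrightarrow> color_refinement G c c'"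
| refine:
    "refinement_step G c c' \<Longrightarrow> \<not> same_partition G c c' \<Longrightarrow> color_refinement G c' d
     \<Longrightarrow> color_refinement G c d"


subsection \<open>Tinhofer's algorithm\<close>

datatype answer = Isomorphic | Not_Isomorphic

definition left_colors :: "'a pair_pre_digraph \<Rightarrow> ('a + 'b \<Rightarrow> nat) \<Rightarrow> nat multiset" where
  "left_colors G c = image_mset (\<lambda>v. c (Inl v)) (mset_set (pverts G))"

definition right_colors :: "'b pair_pre_digraph \<Rightarrow> ('a + 'b \<Rightarrow> nat) \<Rightarrow> nat multiset" where
  "right_colors H c = image_mset (\<lambda>w. c (Inr w)) (mset_set (pverts H))"

text \<open>
  \<open>tinhofer_loop G H c a\<close>: with current coloring \<open>c\<close> of the disjoint union, some sequence of
  choices (of color class \<open>k\<close>, vertices \<open>v\<close> and \<open>w\<close>, and names of new colors) makes the algorithm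
  halt with answer \<open>a\<close>.
\<close>

inductive tinhofer_loop ::
    "'a pair_pre_digraph \<Rightarrow> 'b pair_pre_digraph \<Rightarrow> ('a + 'b \<Rightarrow> nat) \<Rightarrow> answer \<Rightarrow> bool"
  for G H where
  reject:
    "color_refinement (disjoint_union G H) c d \<Longrightarrow>
     left_colors G d \<noteq> right_colors H d \<Longrightarrow>
     tinhofer_loop G H c Not_Isomorphic"
| accept:
    "color_refinement (disjoint_union G H) c d \<Longrightarrow>
     left_colors G d = right_colors H d \<Longrightarrow>
     inj_on (\<lambda>v. d (Inl v)) (pverts G) \<Longrightarrow>
     tinhofer_loop G H c Isomorphic"
| individualize:
    "color_refinement (disjoint_union G H) c d \<Longrightarrow>
     left_colors G d = right_colors H d \<Longrightarrow>
     \<not> inj_on (\<lambda>v. d (Inl v)) (pverts G) \<Longrightarrow>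
     card {x \<in> pverts G. d (Inl x) = k} \<ge> 2 \<Longrightarrow>
     card {y \<in> pverts H. d (Inr y) = k} \<ge> 2 \<Longrightarrow>
     v \<in> pverts G \<Longrightarrow> d (Inl v) = k \<Longrightarrow>
     w \<in> pverts H \<Longrightarrow> d (Inr w) = k \<Longrightarrow>
     new \<notin> d ` pverts (disjoint_union G H) \<Longrightarrow>
     tinhofer_loop G H (d(Inl v := new, Inr w := new)) a \<Longrightarrow>
     tinhofer_loop G H c a"

definition tinhofer_algorithm ::
    "'a pair_pre_digraph \<Rightarrow> 'b pair_pre_digraph \<Rightarrow> answer \<Rightarrow> bool" where
  "tinhofer_algorithm G H a \<longleftrightarrow> tinhofer_loop G H (\<lambda>_. 0) a"

text \<open>
  HOL cannot quantify over types inside a definition, so \<open>H\<close> ranges over the finite graphs with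
  vertices in \<^typ>\<open>nat\<close>; every finite graph is isomorphic to one of these.
\<close>

definition tinhofer_property :: "'a pair_pre_digraph \<Rightarrow> bool" where
  "tinhofer_property G \<longleftrightarrow>
     (\<forall>H :: nat pair_pre_digraph. pair_digraph H \<longrightarrow>
       (\<forall>a. tinhofer_algorithm G H a \<longrightarrow>
         (a = Isomorphic \<longleftrightarrow> digraph_iso (with_proj G) (with_proj H))))"

end

theory Submission
  imports Defs
begin

text \<open>
  The graph \<open>X\<close> is the Shrikhande graph, which is strongly regular with parameters
  \<open>(16, 6, 2, 2)\<close> but not of rank 3: the stabilizer of the vertex \<open>(0, 0)\<close> is not transitive on the
  non-neighbors of \<open>(0, 0)\<close>.  The common neighbors \<open>(0, 1)\<close> and \<open>(0, 3)\<close> of \<open>(0, 0)\<close> and \<open>(0, 2)\<close> are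
  not adjacent, whereas the common neighbors \<open>(0, 1)\<close> and \<open>(1, 1)\<close> of \<open>(0, 0)\<close> and \<open>(1, 2)\<close> are.
  Color Refinement does not see this in time.  Run the algorithm on \<open>X\<close> and a copy of \<open>X\<close>.  Since
  \<open>X\<close> is regular, nothing is split at first, and \<open>(0, 0)\<close> can be matched with its copy.  By strong
  regularity, the partition into \<open>(0, 0)\<close>, its neighbors and its non-neighbors is equitable, so
  \<open>(0, 2)\<close> and the copy of \<open>(1, 2)\<close> still have the same color and may be matched next.  No
  isomorphism maps one pair to the other; Color Refinement now detects the adjacent common
  neighbors and the algorithm rejects, although the two graphs are isomorphic.

  No intermediate coloring has to be computed.  Every run of Color Refinement ends
  (\<open>ex_color_refinement\<close>) in an equitable coloring that is finer than the initial one but coarser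
  than any equitable coloring that is finer than the initial one
  (\<open>color_refinement_coarsest\<close>).  Being coarser than the distance partition is what keeps the two
  vertices together (\<open>individualize_confused\<close>); being finer than the individualized coloring and
  equitable is what forces the final rejection (\<open>reject_if_triangle_mismatch\<close>).  The criterion
  \<open>not_tinhofer_property\<close> combines the three rounds for an arbitrary graph, and the group structure
  reduces its hypotheses for \<open>X\<close> to a check on 16 vertices.
\<close>

section \<open>Equitable colorings and Color Refinement\<close>

definition equitable :: "'a pair_pre_digraph \<Rightarrow> ('a \<Rightarrow> nat) \<Rightarrow> bool" where
  "equitable G c \<longleftrightarrow>
     (\<forall>v\<in>pverts G. \<forall>v'\<in>pverts G. c v = c v' \<longrightarrow> in_colors G c v = in_colors G c v')"

definition finer :: "'a pair_pre_digraph \<Rightarrow> ('a \<Rightarrow> nat) \<Rightarrow> ('a \<Rightarrow> nat) \<Rightarrow> bool" where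
  "finer G d c \<longleftrightarrow> (\<forall>v\<in>pverts G. \<forall>v'\<in>pverts G. d v = d v' \<longrightarrow> c v = c v')"

text \<open>
  A coarser coloring is a renaming of the finer one in which some names may be identified, so the
  coarse color multiset is the image of the fine one.
\<close>

lemma in_colors_eq_if_finer:
  assumes "finer G d c" and "in_colors G d v = in_colors G d v'"
  shows "in_colors G c v = in_colors G c v'"
proof -
  define f where "f k = c (SOME x. x \<in> pverts G \<and> d x = k)" for k
  have f: "f (d x) = c x" if "x \<in> pverts G" for x
  proof -
    have "\<exists>y. y \<in> pverts G \<and> d y = d x" using that by blast
    from someI_ex[OF this] show ?thesis
      using assms(1) that unfolding finer_def f_def by blast
  qed
  have "in_colors G c x = image_mset f (in_colors G d x)" for x
  proof (cases "finite {h \<in> pverts G. (h, x) \<in> parcs G}")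
    case True
    then show ?thesis
      unfolding in_colors_def multiset.map_comp
      by (intro image_mset_cong) (auto simp: f)
  qed (simp add: in_colors_def)
  then show ?thesis using assms(2) by simp
qed

lemma ex_refinement_step:
  assumes "finite (pverts G)"
  shows "\<exists>c'. refinement_step G c c'"
proof -
  let ?f = "\<lambda>v. (c v, in_colors G c v)"
  obtain g :: "nat \<times> nat multiset \<Rightarrow> nat" where g: "inj_on g (?f ` pverts G)"
    using finite_imp_inj_to_nat_seg[of "?f ` pverts G"] assms by blast
  have "refinement_step G c (\<lambda>v. g (?f v))"
    unfolding refinement_step_def using inj_on_eq_iff[OF g] by auto
  then show ?thesis by blast
qed

lemma refinement_step_finer: "refinement_step G c c' \<Longrightarrow> finer G c' c"
  by (auto simp: refinement_step_def finer_def)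

text \<open>
  The iteration ends because each step that changes the partition shrinks the finite set of
  pairs of equally colored vertices.
\<close>

lemma ex_color_refinement:
  assumes "finite (pverts G)"
  shows "\<exists>d. color_refinement G c d"
proof -
  define E where
    "E c = {(v, v'). v \<in> pverts G \<and> v' \<in> pverts G \<and> c v = c v'}" for c :: "'a \<Rightarrow> nat"
  have fin: "finite (E c)" for c
    by (rule finite_subset[of _ "pverts G \<times> pverts G"]) (auto simp: E_def assms)
  show ?thesis
  proof (induction "card (E c)" arbitrary: c rule: less_induct)
    case less
    obtain c' where c': "refinement_step G c c'"
      using ex_refinement_step[OF assms] by blast
    show ?case
    proof (cases "same_partition G c c'")
      case True
      then show ?thesis using c' color_refinement.stable by blast
    next
      case False
      then have "E c' \<subset> E c"
        using refinement_step_finer[OF c']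
        unfolding E_def same_partition_def finer_def by blast
      then have "card (E c') < card (E c)"
        by (rule psubset_card_mono[OF fin])
      from less[OF this] show ?thesis
        using c' False color_refinement.refine by blast
    qed
  qed
qed

lemma color_refinement_finer: "color_refinement G c d \<Longrightarrow> finer G d c"
proof (induction rule: color_refinement.induct)
  case (refine c c' d)
  then show ?case
    using refinement_step_finer[of G c c'] unfolding finer_def by blast
qed (rule refinement_step_finer)

lemma color_refinement_equitable: "color_refinement G c d \<Longrightarrow> equitable G d"
proof (induction rule: color_refinement.induct)
  case (stable c c')
  then have "finer G c c'"
    by (simp add: same_partition_def finer_def)
  then show ?case
    using stable in_colors_eq_if_finer[of G c c']
    unfolding equitable_def refinement_step_def by blast
qed

text \<open>
  An equitable coloring that is finer than the current coloring also determines the current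
  colors of the in-neighbors, so it never puts together two vertices that a step separates.
  This limits how much a run can split without computing any of its intermediate colorings.
\<close>

lemma color_refinement_coarsest:
  "color_refinement G c d \<Longrightarrow> equitable G p \<Longrightarrow> finer G p c \<Longrightarrow> finer G p d"
proof (induction rule: color_refinement.induct)
  case step: (stable c c')
  then show ?case
    using in_colors_eq_if_finer[of G p c]
    unfolding equitable_def refinement_step_def finer_def by blast
next
  case step: (refine c c' d)
  then have "finer G p c'"
    using in_colors_eq_if_finer[of G p c]
    unfolding equitable_def refinement_step_def finer_def by blast
  with step show ?case by blast
qed


section \<open>A graph next to a relabelled copy\<close>

definition relabel :: "('a \<Rightarrow> 'b) \<Rightarrow> 'a pair_pre_digraph \<Rightarrow> 'b pair_pre_digraph" where
  "relabel e G = \<lparr> pverts = e ` pverts G, parcs = map_prod e e ` parcs G \<rparr>"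

lemma pair_digraph_relabel:
  assumes "pair_digraph G" and inj: "inj_on e (pverts G)"
  shows "pair_digraph (relabel e G)"
proof -
  interpret pair_digraph G by fact
  show ?thesis
  proof
    fix a assume a: "a \<in> parcs (relabel e G)"
    then obtain x y where xy: "a = (e x, e y)" "(x, y) \<in> parcs G"
      by (auto simp: relabel_def)
    show "fst a \<in> pverts (relabel e G)" "snd a \<in> pverts (relabel e G)"
      using xy in_arcsD1 in_arcsD2 by (auto simp: relabel_def)
    have "x \<noteq> y" using pair_no_loops[OF xy(2)] by simp
    then show "fst a \<noteq> snd a"
      using xy in_arcsD1 in_arcsD2 inj by (auto dest: inj_onD)
  qed (simp_all add: relabel_def pair_finite_verts pair_finite_arcs)
qed

lemma digraph_iso_relabel:
  assumes "pair_digraph G" and inj: "inj_on e (pverts G)"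
  shows "digraph_iso (with_proj G) (with_proj (relabel e G))"
proof -
  interpret pair_digraph G by fact
  let ?h = "\<lparr> iso_verts = e, iso_arcs = map_prod e e, iso_head = snd, iso_tail = fst \<rparr>"
  have "inj_on (map_prod e e) (parcs G)"
    using inj in_arcsD1 in_arcsD2 by (auto simp: inj_on_def)
  then have "pre_digraph.digraph_isomorphism (with_proj G) ?h"
    using inj wf_digraph by (auto simp: pre_digraph.digraph_isomorphism_def)
  moreover have "with_proj (relabel e G) = app_iso ?h (with_proj G)"
    by (simp add: app_iso_def relabel_def with_proj_def)
  ultimately show ?thesis unfolding digraph_iso_def by blast
qed

locale relabelled_copy = pair_digraph G for G :: "'a pair_pre_digraph" +
  fixes e :: "'a \<Rightarrow> 'b"
  assumes inj: "inj_on e (pverts G)"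
begin

abbreviation "H \<equiv> relabel e G"
abbreviation "U \<equiv> disjoint_union G H"

definition proj :: "'a + 'b \<Rightarrow> 'a" where
  "proj = case_sum id (inv_into (pverts G) e)"

lemma proj_simps [simp]: "proj (Inl x) = x" "x \<in> pverts G \<Longrightarrow> proj (Inr (e x)) = x"
  by (simp_all add: proj_def inj inv_into_f_f)

lemma verts_U: "pverts U = Inl ` pverts G \<union> (\<lambda>x. Inr (e x)) ` pverts G"
  by (auto simp: disjoint_union_def relabel_def)

lemma in_verts_U [simp]:
  "x \<in> pverts G \<Longrightarrow> Inl x \<in> pverts U" "x \<in> pverts G \<Longrightarrow> Inr (e x) \<in> pverts U"
  by (auto simp: verts_U)

lemma finite_verts_U: "finite (pverts U)"
  by (simp add: verts_U pair_finite_verts)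

lemma in_colors_Inl: "in_colors U c (Inl x) = in_colors G (\<lambda>y. c (Inl y)) x"
proof -
  have "{h \<in> pverts U. (h, Inl x) \<in> parcs U} = Inl ` {h \<in> pverts G. (h, x) \<in> parcs G}"
    by (auto simp: disjoint_union_def)
  then show ?thesis
    by (simp add: in_colors_def image_mset_mset_set[symmetric] multiset.map_comp comp_def)
qed

lemma in_colors_Inr:
  assumes "x \<in> pverts G"
  shows "in_colors U c (Inr (e x)) = in_colors G (\<lambda>y. c (Inr (e y))) x"
proof -
  have "{h \<in> pverts U. (h, Inr (e x)) \<in> parcs U}
      = (\<lambda>y. Inr (e y)) ` {h \<in> pverts G. (h, x) \<in> parcs G}"
    using inj in_arcsD1 in_arcsD2 assms
    by (auto simp: disjoint_union_def relabel_def dest: inj_onD)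
  moreover have "inj_on (\<lambda>y. Inr (e y) :: 'a + 'b) {h \<in> pverts G. (h, x) \<in> parcs G}"
    using inj by (auto simp: inj_on_def)
  ultimately show ?thesis
    by (simp add: in_colors_def image_mset_mset_set[symmetric] multiset.map_comp comp_def)
qed

text \<open>
  The projection of the union onto the graph is bijective on the in-neighborhoods, so equitable
  colorings pull back along it.
\<close>

lemma equitable_lift:
  assumes "equitable G p"
  shows "equitable U (\<lambda>u. p (proj u))"
proof -
  have "in_colors U (\<lambda>u. p (proj u)) u = in_colors G p (proj u) \<and> proj u \<in> pverts G"
    if u: "u \<in> pverts U" for u
  proof -
    have "in_colors G (\<lambda>y. p (proj (Inr (e y)))) x = in_colors G p x" for x
      unfolding in_colors_def
      by (rule image_mset_cong) (auto simp: pair_finite_verts)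
    then show ?thesis
      using u by (auto simp: verts_U in_colors_Inl in_colors_Inr)
  qed
  then show ?thesis
    using assms unfolding equitable_def by metis
qed

text \<open>
  A vertex and its copy have the same projection, so a coloring that is coarser than a lifted
  one cannot tell them apart.
\<close>

lemma left_colors_eq_right_colors:
  assumes "finer U (\<lambda>u. p (proj u)) d"
  shows "left_colors G d = right_colors H d"
proof -
  have "right_colors H d = image_mset (\<lambda>x. d (Inr (e x))) (mset_set (pverts G))"
    using inj
    by (simp add: right_colors_def relabel_def image_mset_mset_set[symmetric]
        multiset.map_comp comp_def)
  also have "\<dots> = left_colors G d"
    unfolding left_colors_def
  proof (rule image_mset_cong)
    fix x assume "x \<in># mset_set (pverts G)"
    then have "x \<in> pverts G" by (simp add: pair_finite_verts)
    with assms show "d (Inr (e x)) = d (Inl x)"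
      unfolding finer_def by simp
  qed
  finally show ?thesis by simp
qed

text \<open>
  As long as an equitable coloring \<open>p\<close> of the graph, lifted to the union, is finer than the
  current coloring \<open>c\<close>, the algorithm cannot separate two vertices that agree under \<open>p\<close>, and it
  may pair one of them with the copy of the other.
\<close>

lemma individualize_confused:
  assumes p: "equitable G p" and c: "finer U (\<lambda>u. p (proj u)) c"
    and xy: "x \<in> pverts G" "y \<in> pverts G" "p x = p y"
    and vw: "v \<in> pverts G" "w \<in> pverts G" "p v = p x" "p w = p x" "v \<noteq> w"
    and continue: "\<And>d new. finer U d c \<Longrightarrow> finer U (\<lambda>u. p (proj u)) d \<Longrightarrow>
      new \<notin> d ` pverts U \<Longrightarrow> tinhofer_loop G H (d(Inl x := new, Inr (e y) := new)) a"
  shows "tinhofer_loop G H c a"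
proof -
  obtain d where d: "color_refinement U c d"
    using ex_color_refinement[OF finite_verts_U] by blast
  have pd: "finer U (\<lambda>u. p (proj u)) d"
    by (rule color_refinement_coarsest[OF d equitable_lift[OF p] c])
  have same: "d (Inl z) = d (Inl x) \<and> d (Inr (e z)) = d (Inl x)"
    if "z \<in> pverts G" "p z = p x" for z
    using pd that xy(1) unfolding finer_def by simp
  obtain new where new: "new \<notin> d ` pverts U"
    using ex_new_if_finite[OF infinite_UNIV_nat] finite_verts_U by blast
  have card2: "card A \<ge> 2" if "finite A" "s \<in> A" "t \<in> A" "s \<noteq> t" for A :: "'c set" and s t
    using card_mono[of A "{s, t}"] that by simp
  show ?thesis
  proof (rule tinhofer_loop.individualize[OF d])
    show "left_colors G d = right_colors H d"
      by (rule left_colors_eq_right_colors[OF pd])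
    show "\<not> inj_on (\<lambda>v. d (Inl v)) (pverts G)"
      using same vw unfolding inj_on_def by metis
    show "card {z \<in> pverts G. d (Inl z) = d (Inl x)} \<ge> 2"
      by (rule card2[of _ v w]) (use same vw pair_finite_verts in auto)
    have "e v \<noteq> e w" using inj vw by (auto dest: inj_onD)
    then show "card {z \<in> pverts H. d (Inr z) = d (Inl x)} \<ge> 2"
      by (intro card2[of _ "e v" "e w"])
        (use same vw pair_finite_verts in \<open>auto simp: relabel_def\<close>)
    show "tinhofer_loop G H (d(Inl x := new, Inr (e y) := new)) a"
      by (rule continue[OF color_refinement_finer[OF d] pd new])
    show "e y \<in> pverts H" "d (Inr (e y)) = d (Inl x)"
      using same[of y] xy by (simp_all add: relabel_def)
  qed (use xy new in simp_all)
qed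

lemma copy_in_neighbor:
  assumes d: "equitable U d"
    and x: "x \<in> pverts G" and y: "y \<in> pverts G" "d (Inl x) = d (Inr (e y))"
    and hy: "(h, y) \<in> parcs G"
  obtains g where "(g, x) \<in> parcs G" "d (Inl g) = d (Inr (e h))"
proof -
  have fin: "finite {h \<in> pverts G. (h, z) \<in> parcs G}" for z
    by (simp add: pair_finite_verts)
  have "in_colors U d (Inl x) = in_colors U d (Inr (e y))"
    using d x y unfolding equitable_def by simp
  moreover have "d (Inr (e h)) \<in># in_colors G (\<lambda>y. d (Inr (e y))) y"
    using hy in_arcsD1 fin by (auto simp: in_colors_def)
  ultimately have "d (Inr (e h)) \<in># in_colors G (\<lambda>y. d (Inl y)) x"
    using y by (simp add: in_colors_Inl in_colors_Inr)
  then show ?thesis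
    using that fin by (auto simp: in_colors_def)
qed

text \<open>
  Here \<open>c\<close> is a coloring in which \<open>o1\<close> has been matched with its copy and \<open>v\<close> with the copy of \<open>w\<close>.
  If the color multisets agreed after refinement, the copy of \<open>z\<close> would have the color of some
  vertex \<open>u\<close> of \<open>G\<close>.  Equal colors force equally colored in-neighbors, and the colors of the
  matched vertices are shared by no further vertex, so \<open>u\<close> would be a common out-neighbor of \<open>o1\<close>
  and \<open>v\<close>, with another one, colored like the copy of \<open>z'\<close>, as an in-neighbor.
  This is what the assumption on \<open>o1\<close> and \<open>v\<close> excludes.
\<close>

lemma reject_if_triangle_mismatch:
  assumes o: "o1 \<in> pverts G" and v: "v \<in> pverts G" and w: "w \<in> pverts G"
    and o_alone: "\<And>x. x \<in> pverts G \<Longrightarrow> c (Inl x) = c (Inr (e o1)) \<Longrightarrow> x = o1"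
    and v_alone: "\<And>x. x \<in> pverts G \<Longrightarrow> c (Inl x) = c (Inr (e w)) \<Longrightarrow> x = v"
    and arcs: "(o1, z) \<in> parcs G" "(w, z) \<in> parcs G" "(o1, z') \<in> parcs G" "(w, z') \<in> parcs G"
      "(z', z) \<in> parcs G"
    and no_arcs: "\<And>u u'. (o1, u) \<in> parcs G \<Longrightarrow> (v, u) \<in> parcs G \<Longrightarrow>
      (o1, u') \<in> parcs G \<Longrightarrow> (v, u') \<in> parcs G \<Longrightarrow> (u', u) \<in> parcs G \<Longrightarrow> False"
  shows "tinhofer_loop G H c Not_Isomorphic"
proof -
  obtain d where d: "color_refinement U c d"
    using ex_color_refinement[OF finite_verts_U] by blast
  have eq: "equitable U d" and ref: "finer U d c"
    using d by (auto intro: color_refinement_equitable color_refinement_finer)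
  have common: "(o1, u) \<in> parcs G \<and> (v, u) \<in> parcs G"
    if u: "u \<in> pverts G" and y: "d (Inl u) = d (Inr (e y))" "y \<in> pverts G"
      "(o1, y) \<in> parcs G" "(w, y) \<in> parcs G" for u y
  proof -
    obtain g where g: "(g, u) \<in> parcs G" "d (Inl g) = d (Inr (e o1))"
      using copy_in_neighbor[OF eq u y(2,1,3)] .
    obtain g' where g': "(g', u) \<in> parcs G" "d (Inl g') = d (Inr (e w))"
      using copy_in_neighbor[OF eq u y(2,1,4)] .
    have "g \<in> pverts G" "g' \<in> pverts G" using g g' in_arcsD1 by auto
    then have "g = o1" "g' = v"
      using ref g g' o w o_alone v_alone unfolding finer_def by auto
    with g g' show ?thesis by simp
  qed
  show ?thesis
  proof (rule tinhofer_loop.reject[OF d])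
    show "left_colors G d \<noteq> right_colors H d"
    proof
      assume "left_colors G d = right_colors H d"
      then have sets: "(\<lambda>x. d (Inl x)) ` pverts G = (\<lambda>y. d (Inr y)) ` pverts H"
        unfolding left_colors_def right_colors_def
        by (auto simp: pair_finite_verts relabel_def dest!: arg_cong[of _ _ set_mset])
      have z: "z \<in> pverts G" "z' \<in> pverts G" using arcs in_arcsD2 by auto
      then have "d (Inr (e z)) \<in> (\<lambda>x. d (Inl x)) ` pverts G"
        unfolding sets by (auto simp: relabel_def)
      then obtain u where u: "u \<in> pverts G" "d (Inl u) = d (Inr (e z))" by auto
      obtain u' where u': "(u', u) \<in> parcs G" "d (Inl u') = d (Inr (e z'))"
        using copy_in_neighbor[OF eq u(1) z(1) u(2) arcs(5)] .
      have "u' \<in> pverts G" using u' in_arcsD1 by auto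
      then show False
        using common[OF u z(1) arcs(1,2)] common[OF _ u'(2) z(2) arcs(3,4)] no_arcs u'(1)
        by blast
    qed
  qed
qed

end


section \<open>A criterion for failure\<close>

text \<open>
  The algorithm is run on \<open>G\<close> and a copy of \<open>G\<close> with vertices in \<^typ>\<open>nat\<close>.  Regularity lets it match
  \<open>o1\<close> with its copy.  Since \<open>o1\<close> is alone in its class of the equitable coloring \<open>p\<close>, that
  coloring stays finer than the current one, so the second round may match \<open>v\<close> with the copy of
  \<open>w\<close>.  The arc from \<open>z'\<close> to \<open>z\<close> then exposes the mismatch.
\<close>

theorem not_tinhofer_property:
  fixes G :: "'a pair_pre_digraph"
  assumes G: "pair_digraph G"
    and regular: "equitable G (\<lambda>_. 0)"
    and p: "equitable G p"
    and o: "o1 \<in> pverts G" and o_alone: "\<And>x. x \<in> pverts G \<Longrightarrow> p x = p o1 \<Longrightarrow> x = o1"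
    and vw: "v \<in> pverts G" "w \<in> pverts G" "v \<noteq> w" "p v = p w"
    and arcs: "(o1, z) \<in> parcs G" "(w, z) \<in> parcs G" "(o1, z') \<in> parcs G" "(w, z') \<in> parcs G"
      "(z', z) \<in> parcs G"
    and no_arcs: "\<And>u u'. (o1, u) \<in> parcs G \<Longrightarrow> (v, u) \<in> parcs G \<Longrightarrow>
      (o1, u') \<in> parcs G \<Longrightarrow> (v, u') \<in> parcs G \<Longrightarrow> (u', u) \<in> parcs G \<Longrightarrow> False"
  shows "\<not> tinhofer_property G"
proof
  assume tinhofer: "tinhofer_property G"
  interpret pair_digraph G by fact
  obtain e :: "'a \<Rightarrow> nat" where e: "inj_on e (pverts G)"
    using finite_imp_inj_to_nat_seg[OF pair_finite_verts] by blast
  interpret relabelled_copy G e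
    by unfold_locales (rule e)
  have "o1 \<noteq> v" "o1 \<noteq> w"
    using o_alone vw by metis+
  have "tinhofer_loop G H (\<lambda>_. 0) Not_Isomorphic"
  proof (rule individualize_confused[OF regular, of _ o1 o1 v w])
    fix d new
    assume d: "finer U (\<lambda>u. 0) d" and new: "new \<notin> d ` pverts U"
    \<comment> \<open>the coloring after the first choice; \<open>d'\<close> below is the stable coloring of the second round\<close>
    let ?c1 = "d(Inl o1 := new, Inr (e o1) := new)"
    show "tinhofer_loop G H ?c1 Not_Isomorphic"
    proof (rule individualize_confused[OF p, of _ v w v w])
      show "finer U (\<lambda>u. p (proj u)) ?c1"
      proof -
        have "proj u = o1 \<longleftrightarrow> u = Inl o1 \<or> u = Inr (e o1)" if "u \<in> pverts U" for u
          using that o by (auto simp: verts_U)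
        moreover have "proj u \<in> pverts G" if "u \<in> pverts U" for u
          using that by (auto simp: verts_U)
        ultimately show ?thesis
          using d o_alone unfolding finer_def by (smt (verit) fun_upd_apply)
      qed
    next
      fix d' new'
      assume d': "finer U d' ?c1" and new': "new' \<notin> d' ` pverts U"
      show "tinhofer_loop G H (d'(Inl v := new', Inr (e w) := new')) Not_Isomorphic"
      proof (rule reject_if_triangle_mismatch[OF o vw(1,2) _ _ arcs no_arcs])
        have ne: "e o1 \<noteq> e w" using e o vw \<open>o1 \<noteq> w\<close> by (auto dest: inj_onD)
        show "x = o1"
          if x: "x \<in> pverts G"
            and eq: "(d'(Inl v := new', Inr (e w) := new')) (Inl x)
              = (d'(Inl v := new', Inr (e w) := new')) (Inr (e o1))" for x
        proof (rule ccontr)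
          assume "x \<noteq> o1"
          have "d' (Inr (e o1)) \<noteq> new'" using new' o by auto
          then have "d' (Inl x) = d' (Inr (e o1))"
            using eq ne by (auto split: if_splits)
          then have "?c1 (Inl x) = ?c1 (Inr (e o1))"
            using d' in_verts_U(1)[OF x] in_verts_U(2)[OF o] unfolding finer_def by blast
          then have "d (Inl x) = new" using \<open>x \<noteq> o1\<close> by simp
          then show False using new x by auto
        qed
        show "x = v"
          if x: "x \<in> pverts G"
            and eq: "(d'(Inl v := new', Inr (e w) := new')) (Inl x)
              = (d'(Inl v := new', Inr (e w) := new')) (Inr (e w))" for x
          using eq new' x by (auto split: if_splits)
      qed
    qed (use vw in auto)
  qed (use o vw in \<open>auto simp: finer_def\<close>)
  then show False
    using tinhofer pair_digraph_relabel[OF G e] digraph_iso_relabel[OF G e]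
    unfolding tinhofer_property_def tinhofer_algorithm_def by blast
qed


section \<open>Cayley graphs\<close>

context group
begin

lemma cayley_arc_iff:
  assumes "S \<subseteq> carrier G"
  shows "(h, v) \<in> parcs (cayley_graph G S) \<longleftrightarrow>
    h \<in> carrier G \<and> v \<in> carrier G \<and> v \<otimes> inv h \<in> S"
proof
  assume "(h, v) \<in> parcs (cayley_graph G S)"
  then show "h \<in> carrier G \<and> v \<in> carrier G \<and> v \<otimes> inv h \<in> S"
    using assms by (auto simp: cayley_graph_def m_assoc subset_iff)
next
  assume *: "h \<in> carrier G \<and> v \<in> carrier G \<and> v \<otimes> inv h \<in> S"
  then have "v = (v \<otimes> inv h) \<otimes> h" by (simp add: m_assoc)
  with * show "(h, v) \<in> parcs (cayley_graph G S)"
    unfolding cayley_graph_def by auto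
qed

lemma pair_digraph_cayley:
  assumes "finite (carrier G)" and S: "S \<subseteq> carrier G - {\<one>}"
  shows "pair_digraph (cayley_graph G S)"
proof -
  have S': "S \<subseteq> carrier G" using S by blast
  show ?thesis
  proof
    fix a assume a: "a \<in> parcs (cayley_graph G S)"
    obtain h v where hv: "a = (h, v)" by (cases a)
    note * = a[unfolded hv cayley_arc_iff[OF S']]
    show "fst a \<in> pverts (cayley_graph G S)" "snd a \<in> pverts (cayley_graph G S)"
      using * hv by (simp_all add: cayley_graph_def)
    show "fst a \<noteq> snd a" using * hv S by auto
  next
    show "finite (pverts (cayley_graph G S))"
      using assms(1) by (simp add: cayley_graph_def)
    have "parcs (cayley_graph G S) \<subseteq> carrier G \<times> carrier G"
      by (auto simp: cayley_arc_iff[OF S'])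
    then show "finite (parcs (cayley_graph G S))"
      using assms(1) finite_subset by blast
  qed
qed

lemma symmetric_cayley:
  assumes S: "S \<subseteq> carrier G" and inv: "\<And>s. s \<in> S \<Longrightarrow> inv s \<in> S"
  shows "symmetric (with_proj (cayley_graph G S))"
proof -
  have "(v, h) \<in> parcs (cayley_graph G S)" if "(h, v) \<in> parcs (cayley_graph G S)" for h v
  proof -
    have *: "h \<in> carrier G" "v \<in> carrier G" "v \<otimes> inv h \<in> S"
      using that by (auto simp: cayley_arc_iff[OF S])
    then have "h \<otimes> inv v = inv (v \<otimes> inv h)" by (simp add: inv_mult_group)
    with * show ?thesis using inv by (simp add: cayley_arc_iff[OF S])
  qed
  then show ?thesis by (auto simp: symmetric_def sym_def)
qed

text \<open>
  The in-neighbors of \<open>v\<close> correspond to the connection set.  In particular all in-degrees agree,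
  which is the starting point of every run.
\<close>

lemma in_colors_cayley:
  assumes S: "S \<subseteq> carrier G" and v: "v \<in> carrier G"
  shows "in_colors (cayley_graph G S) c v = {#c (inv s \<otimes> v). s \<in># mset_set S#}"
proof -
  have "{h \<in> pverts (cayley_graph G S). (h, v) \<in> parcs (cayley_graph G S)}
      = (\<lambda>s. inv s \<otimes> v) ` S"
  proof (intro equalityI subsetI)
    fix h assume "h \<in> {h \<in> pverts (cayley_graph G S). (h, v) \<in> parcs (cayley_graph G S)}"
    then have h: "h \<in> carrier G" "v \<otimes> inv h \<in> S" by (auto simp: cayley_arc_iff[OF S])
    then have "h = inv (v \<otimes> inv h) \<otimes> v" using v by (simp add: inv_mult_group m_assoc)
    with h show "h \<in> (\<lambda>s. inv s \<otimes> v) ` S" by blast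
  next
    fix h assume "h \<in> (\<lambda>s. inv s \<otimes> v) ` S"
    then obtain s where s: "s \<in> S" "h = inv s \<otimes> v" by blast
    then have "s \<in> carrier G" using S by blast
    moreover from this have "v \<otimes> inv h = s"
      using s v by (simp add: inv_mult_group m_assoc[symmetric])
    ultimately show "h \<in> {h \<in> pverts (cayley_graph G S). (h, v) \<in> parcs (cayley_graph G S)}"
      using s v by (simp add: cayley_arc_iff[OF S]) (simp add: cayley_graph_def)
  qed
  moreover have "inj_on (\<lambda>s. inv s \<otimes> v) S"
    using S v by (auto simp: inj_on_def subset_iff dest: inj_onD[OF inv_inj])
  ultimately show ?thesis
    by (simp add: in_colors_def image_mset_mset_set[symmetric] multiset.map_comp comp_def)
qed

lemma regular_cayley: "S \<subseteq> carrier G \<Longrightarrow> equitable (cayley_graph G S) (\<lambda>_. k)"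
  unfolding equitable_def using in_colors_cayley[of S]
  by (simp add: cayley_graph_def)

end


section \<open>The Shrikhande graph\<close>

definition Z4Z4 :: "(int \<times> int) monoid" where
  "Z4Z4 = integer_mod_group 4 \<times>\<times> integer_mod_group 4"

definition conn :: "(int \<times> int) set" where
  "conn = {(1,0), (3,0), (0,1), (0,3), (1,1), (3,3)}"

definition shrikhande :: "(int \<times> int) pair_pre_digraph" where
  "shrikhande = cayley_graph Z4Z4 conn"

lemma carrier_Z4Z4: "carrier Z4Z4 = {0,1,2,3} \<times> {0,1,2,3}"
proof -
  have "{0..<4} = {0,1,2,3::int}" by auto
  then show ?thesis by (simp add: Z4Z4_def carrier_integer_mod_group)
qed

lemma one_Z4Z4: "\<one>\<^bsub>Z4Z4\<^esub> = (0, 0)"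
  by (simp add: Z4Z4_def)

lemma mult_Z4Z4: "(a, b) \<otimes>\<^bsub>Z4Z4\<^esub> (c, d) = ((a + c) mod 4, (b + d) mod 4)"
  by (simp add: Z4Z4_def)

lemma comm_group_Z4Z4: "comm_group Z4Z4"
proof -
  have "group Z4Z4"
    unfolding Z4Z4_def by (rule DirProd_group) simp_all
  then show ?thesis
    by (rule group.group_comm_groupI) (auto simp: mult_Z4Z4 add.commute)
qed

interpretation Z4Z4: comm_group Z4Z4
  by (rule comm_group_Z4Z4)

lemma inv_Z4Z4:
  "(a, b) \<in> carrier Z4Z4 \<Longrightarrow> inv\<^bsub>Z4Z4\<^esub> (a, b) = ((- a) mod 4, (- b) mod 4)"
  unfolding Z4Z4_def by (simp add: inv_DirProd)

lemma conn_subset: "conn \<subseteq> carrier Z4Z4 - {\<one>\<^bsub>Z4Z4\<^esub>}" "conn \<subseteq> carrier Z4Z4"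
  by (simp_all add: conn_def carrier_Z4Z4 one_Z4Z4)

lemma verts_shrikhande: "pverts shrikhande = {0,1,2,3} \<times> {0,1,2,3}"
  by (simp add: shrikhande_def cayley_graph_def carrier_Z4Z4)

lemma arc_shrikhande:
  "((a, b), (c, d)) \<in> parcs shrikhande \<longleftrightarrow>
     (a, b) \<in> carrier Z4Z4 \<and> (c, d) \<in> carrier Z4Z4 \<and> ((c - a) mod 4, (d - b) mod 4) \<in> conn"
  unfolding shrikhande_def Z4Z4.cayley_arc_iff[OF conn_subset(2)]
  by (auto simp: inv_Z4Z4 mult_Z4Z4 mod_simps)

lemma symmetric_shrikhande: "symmetric (with_proj shrikhande)"
  unfolding shrikhande_def
  by (rule Z4Z4.symmetric_cayley[OF conn_subset(2)])
    (auto simp: conn_def inv_Z4Z4 carrier_Z4Z4)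

lemma in_colors_shrikhande:
  assumes "(a, b) \<in> carrier Z4Z4"
  shows "in_colors shrikhande c (a, b) =
    {#c ((a+3) mod 4, b mod 4), c ((a+1) mod 4, b mod 4), c (a mod 4, (b+3) mod 4),
      c (a mod 4, (b+1) mod 4), c ((a+3) mod 4, (b+3) mod 4), c ((a+1) mod 4, (b+1) mod 4)#}"
  unfolding shrikhande_def Z4Z4.in_colors_cayley[OF conn_subset(2) assms]
  by (simp add: conn_def inv_Z4Z4 carrier_Z4Z4 mult_Z4Z4 add.commute)

definition distance_coloring :: "int \<times> int \<Rightarrow> nat" where
  "distance_coloring x = (if x = (0, 0) then 0 else if x \<in> conn then 1 else 2)"

text \<open>
  Strong regularity, as far as it concerns the vertex \<open>(0, 0)\<close>: two adjacent or two distinct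
  non-adjacent vertices always have two common neighbors, which determines the colors of the
  in-neighbors below.
\<close>

lemma equitable_distance_coloring: "equitable shrikhande distance_coloring"
proof -
  have "in_colors shrikhande distance_coloring x =
      (if x = (0, 0) then {#1, 1, 1, 1, 1, 1#}
       else if x \<in> conn then {#0, 1, 1, 2, 2, 2#} else {#1, 1, 2, 2, 2, 2#})"
    if "x \<in> pverts shrikhande" for x
    using that unfolding verts_shrikhande
    by (elim SigmaE insertE emptyE; hypsubst; subst in_colors_shrikhande)
      (simp_all add: carrier_Z4Z4 distance_coloring_def conn_def)
  then show ?thesis
    unfolding equitable_def by (auto simp: distance_coloring_def split: if_splits)
qed

lemma not_tinhofer_shrikhande: "\<not> tinhofer_property shrikhande"
proof (rule not_tinhofer_property[where p = distance_coloring
      and ?o1.0 = "(0, 0)" and v = "(0, 2)" and w = "(1, 2)" and z = "(0, 1)" and z' = "(1, 1)"])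
  show "pair_digraph shrikhande"
    unfolding shrikhande_def
    by (rule Z4Z4.pair_digraph_cayley[OF _ conn_subset(1)]) (simp add: carrier_Z4Z4)
  show "equitable shrikhande (\<lambda>_. 0)"
    unfolding shrikhande_def by (rule Z4Z4.regular_cayley[OF conn_subset(2)])
  have common: "u \<in> {(0, 1), (0, 3)}"
    if u: "((0, 0), u) \<in> parcs shrikhande" "((0, 2), u) \<in> parcs shrikhande" for u
  proof -
    have "u \<in> {0,1,2,3} \<times> {0,1,2,3}"
      using u(1) by (cases u) (simp only: arc_shrikhande carrier_Z4Z4)
    then show ?thesis
      using u by (elim SigmaE insertE emptyE; simp add: arc_shrikhande conn_def)
  qed
  show False if "((0, 0), u) \<in> parcs shrikhande" "((0, 2), u) \<in> parcs shrikhande"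
    "((0, 0), u') \<in> parcs shrikhande" "((0, 2), u') \<in> parcs shrikhande"
    "(u', u) \<in> parcs shrikhande" for u u'
    using common[OF that(1,2)] common[OF that(3,4)] that(5)
    by (auto simp: arc_shrikhande conn_def)
qed (auto simp: equitable_distance_coloring verts_shrikhande distance_coloring_def
    arc_shrikhande carrier_Z4Z4 conn_def split: if_splits)

theorem mainTheorem8:
  shows "(let A = integer_mod_group 4 \<times>\<times> integer_mod_group 4;
              S = {(1,0), (3,0), (0,1), (0,3), (1,1), (3,3)};
              X = cayley_graph A S
          in comm_group A \<and> finite (carrier A) \<and> S \<subseteq> carrier A - {\<one>\<^bsub>A\<^esub>} \<and>
             symmetric (with_proj X) \<and> \<not> tinhofer_property X) \<and>
         \<not> (\<forall>(B :: (int \<times> int) monoid) T.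
              comm_group B \<longrightarrow> finite (carrier B) \<longrightarrow> T \<subseteq> carrier B - {\<one>\<^bsub>B\<^esub>} \<longrightarrow>
              symmetric (with_proj (cayley_graph B T)) \<longrightarrow>
              tinhofer_property (cayley_graph B T))"
proof -
  have "comm_group Z4Z4 \<and> finite (carrier Z4Z4) \<and> conn \<subseteq> carrier Z4Z4 - {\<one>\<^bsub>Z4Z4\<^esub>} \<and>
      symmetric (with_proj shrikhande) \<and> \<not> tinhofer_property shrikhande"
    using comm_group_Z4Z4 conn_subset symmetric_shrikhande not_tinhofer_shrikhande
    by (simp add: carrier_Z4Z4)
  then show ?thesis
    unfolding Let_def shrikhande_def Z4Z4_def[symmetric] conn_def[symmetric] by blast
qed

end
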